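(* As formal power series in $x$, $$(c_2 c_3+c_3 c_1+c_1 c_2) (e^{\alpha x}+e^{\beta x}+ e^{\gamma x})=\frac{-1}{22}\sum_{k=0}^\infty T_k^{(3,1,3)}\frac{x^k}{k!}.$$
   Context: Let $\alpha,\beta,\gamma$ be the three distinct complex roots of $x^3-x^2-x-1=0$, and set $c_1=\frac{\alpha}{(\alpha-\beta)(\alpha-\gamma)}$, $c_2=\frac{\beta}{(\beta-\alpha)(\beta-\gamma)}$, $c_3=\frac{\gamma}{(\gamma-\alpha)(\gamma-\beta)}$. For numbers $s_0,s_1,s_2$, the sequence $T_k^{(s_0,s_1,s_2)}$ is defined by $T_0^{(s_0,s_1,s_2)}=s_0$, $T_1^{(s_0,s_1,s_2)}=s_1$, $T_2^{(s_0,s_1,s_2)}=s_2$ and $T_k^{(s_0,s_1,s_2)}=T_{k-1}^{(s_0,s_1,s_2)}+T_{k-2}^{(s_0,s_1,s_2)}+T_{k-3}^{(s_0,s_1,s_2)}$ for $k\ge3$. *)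

theory Defs
  imports Complex_Main "HOL-Computational_Algebra.Formal_Power_Series"
begin

fun trib :: "'a::ab_semigroup_add \<Rightarrow> 'a \<Rightarrow> 'a \<Rightarrow> nat \<Rightarrow> 'a" where
  "trib s0 s1 s2 0 = s0"
| "trib s0 s1 s2 (Suc 0) = s1"
| "trib s0 s1 s2 (Suc (Suc 0)) = s2"
| "trib s0 s1 s2 (Suc (Suc (Suc k))) =
     trib s0 s1 s2 (Suc (Suc k)) + trib s0 s1 s2 (Suc k) + trib s0 s1 s2 k"

end

theory Submission
  imports Defs
begin

text \<open>
  By Vieta the elementary symmetric functions of the roots are \<open>e1 = 1\<close>, \<open>e2 = - 1\<close>, \<open>e3 = 1\<close>.
  The coefficients \<open>c_i\<close> have a common denominator whose square is the discriminant \<open>- 44\<close>,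
  and \<open>c2 c3 + c3 c1 + c1 c2 = - (e2^2 - 3 e1 e3) / (- 44) = - 1 / 22\<close>. The power sums of
  the roots obey the tribonacci recurrence with initial values \<open>3, 1, 3\<close>, and they are the
  coefficients (up to \<open>k!\<close>) of the sum of the exponentials.
\<close>

text \<open>Subtracting the equations of two distinct roots leaves a multiple of their difference,
  which cancels in an integral domain; no factorization of the cubic is needed.\<close>

lemma cubic_vieta:
  fixes a b c p q r :: "'a::idom"
  assumes a: "a ^ 3 - p * a ^ 2 + q * a - r = 0"
    and b: "b ^ 3 - p * b ^ 2 + q * b - r = 0"
    and c: "c ^ 3 - p * c ^ 2 + q * c - r = 0"
    and ne: "a \<noteq> b" "a \<noteq> c" "b \<noteq> c"
  shows "a + b + c = p" "b * c + c * a + a * b = q" "a * b * c = r"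
proof -
  have ab: "a\<^sup>2 + a * b + b\<^sup>2 - p * (a + b) + q = 0"
  proof -
    have "(a - b) * (a\<^sup>2 + a * b + b\<^sup>2 - p * (a + b) + q) = 0"
      using a b by algebra
    then show ?thesis using ne by simp
  qed
  have ac: "a\<^sup>2 + a * c + c\<^sup>2 - p * (a + c) + q = 0"
  proof -
    have "(a - c) * (a\<^sup>2 + a * c + c\<^sup>2 - p * (a + c) + q) = 0"
      using a c by algebra
    then show ?thesis using ne by simp
  qed
  \<comment> \<open>The difference of the two quadratic relations, in which \<open>q\<close> drops
    out.\<close>
  have "(b - c) * (a + b + c - p) = 0"
    using ab ac by algebra
  then show e1: "a + b + c = p" using ne by simp
  show e2: "b * c + c * a + a * b = q"
    using ab e1 by algebra
  show "a * b * c = r"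
    using a e1 e2 by algebra
qed

text \<open>The right side is the discriminant of \<open>x^3 - p x^2 + q x - r\<close>.\<close>

lemma cubic_discriminant:
  fixes a b c :: "'a::idom"
  assumes "a + b + c = p" "b * c + c * a + a * b = q" "a * b * c = r"
  shows "((a - b) * (a - c) * (b - c))\<^sup>2
       = p\<^sup>2 * q\<^sup>2 - 4 * q ^ 3 - 4 * p ^ 3 * r + 18 * p * q * r - 27 * r\<^sup>2"
  unfolding assms[symmetric] by algebra

text \<open>The Vandermonde product \<open>V\<close> clears the denominator of each coefficient, so
  \<open>V\<close> squared clears those of the pairwise products and leaves a symmetric
  polynomial.\<close>

lemma sum_pairwise_products_lagrange_coeffs:
  fixes a b c :: "'a::field"
  assumes ne: "a \<noteq> b" "a \<noteq> c" "b \<noteq> c"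
    and "c1 = a / ((a - b) * (a - c))"
    and "c2 = b / ((b - a) * (b - c))"
    and "c3 = c / ((c - a) * (c - b))"
  shows "(c2 * c3 + c3 * c1 + c1 * c2) * ((a - b) * (a - c) * (b - c))\<^sup>2
       = 3 * (a + b + c) * (a * b * c) - (b * c + c * a + a * b)\<^sup>2"
proof -
  define V where "V = (a - b) * (a - c) * (b - c)"
  have c: "c1 * V = a * (b - c)" "c2 * V = - b * (a - c)" "c3 * V = c * (a - b)"
    unfolding V_def assms(4-6) using ne by (simp_all add: divide_simps) (simp_all add: algebra_simps)
  have "(c2 * c3 + c3 * c1 + c1 * c2) * V\<^sup>2
      = (c2 * V) * (c3 * V) + (c3 * V) * (c1 * V) + (c1 * V) * (c2 * V)"
    by algebra
  also have "\<dots> = 3 * (a + b + c) * (a * b * c) - (b * c + c * a + a * b)\<^sup>2"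
    unfolding c by algebra
  finally show ?thesis unfolding V_def .
qed

text \<open>The powers of each root satisfy the tribonacci recurrence, which is linear and so passes
  to their sum.\<close>

lemma power_sum_eq_trib:
  fixes a b c :: "'a::comm_ring_1"
  assumes "a ^ 3 = a\<^sup>2 + a + 1" "b ^ 3 = b\<^sup>2 + b + 1" "c ^ 3 = c\<^sup>2 + c + 1"
  shows "a ^ k + b ^ k + c ^ k = trib 3 (a + b + c) (a\<^sup>2 + b\<^sup>2 + c\<^sup>2) k"
proof -
  have step: "x ^ Suc (Suc (Suc n)) = x ^ Suc (Suc n) + x ^ Suc n + x ^ n"
    if "x ^ 3 = x\<^sup>2 + x + 1" for x :: 'a and n
  proof -
    have "x ^ Suc (Suc (Suc n)) = x ^ n * x ^ 3"
      by (simp add: power3_eq_cube mult_ac)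
    then show ?thesis
      by (simp add: that algebra_simps power2_eq_square)
  qed
  show ?thesis
  proof (induction "3 :: 'a" "a + b + c" "a\<^sup>2 + b\<^sup>2 + c\<^sup>2" k rule: trib.induct)
    case (4 k)
    then show ?case
      by (simp only: trib.simps step[OF assms(1)] step[OF assms(2)] step[OF assms(3)])
        \<comment> \<open>Regroups the nine powers by exponent to match the three induction
          hypotheses.\<close>
        (metis (no_types, lifting) add.assoc add.commute add.left_commute)
  qed (simp_all add: power2_eq_square)
qed

theorem corollary1:
  fixes \<alpha> \<beta> \<gamma> c1 c2 c3 :: complex
  assumes "{x :: complex. x ^ 3 - x ^ 2 - x - 1 = 0} = {\<alpha>, \<beta>, \<gamma>}"
    and "\<alpha> \<noteq> \<beta>" and "\<alpha> \<noteq> \<gamma>" and "\<beta> \<noteq> \<gamma>"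
    and "c1 = \<alpha> / ((\<alpha> - \<beta>) * (\<alpha> - \<gamma>))"
    and "c2 = \<beta> / ((\<beta> - \<alpha>) * (\<beta> - \<gamma>))"
    and "c3 = \<gamma> / ((\<gamma> - \<alpha>) * (\<gamma> - \<beta>))"
  shows "fps_const (c2 * c3 + c3 * c1 + c1 * c2) * (fps_exp \<alpha> + fps_exp \<beta> + fps_exp \<gamma>)
       = fps_const (- 1 / 22) * Abs_fps (\<lambda>k. trib 3 1 3 k / fact k)"
proof -
  have roots: "x ^ 3 - x\<^sup>2 - x - 1 = 0" if "x \<in> {\<alpha>, \<beta>, \<gamma>}" for x
    using that unfolding assms(1)[symmetric] by simp
  \<comment> \<open>The coefficients \<open>1\<close>, \<open>- 1\<close>, \<open>1\<close> are
    spelled out to match the shape of \<open>cubic_vieta\<close>.\<close>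
  have vieta_form: "x ^ 3 - 1 * x\<^sup>2 + (- 1) * x - 1 = 0" if "x \<in> {\<alpha>, \<beta>, \<gamma>}" for x
    using roots[OF that] by simp
  have e: "\<alpha> + \<beta> + \<gamma> = 1" "\<beta> * \<gamma> + \<gamma> * \<alpha> + \<alpha> * \<beta> = - 1" "\<alpha> * \<beta> * \<gamma> = 1"
    using cubic_vieta[of \<alpha> 1 "- 1" 1 \<beta> \<gamma>, OF vieta_form vieta_form vieta_form] assms(2-4)
    by simp_all
  \<comment> \<open>The discriminant is 1 + 4 - 4 - 18 - 27 = -44, and the right side is 3 - 1 =
    2.\<close>
  have "(c2 * c3 + c3 * c1 + c1 * c2) * (- 44) = 2"
    using sum_pairwise_products_lagrange_coeffs[OF assms(2-7)]
    unfolding cubic_discriminant[OF e] e by simp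
  then have "c2 * c3 + c3 * c1 + c1 * c2 = 2 / (- 44)"
    by (subst eq_divide_eq) simp
  then have coeff: "c2 * c3 + c3 * c1 + c1 * c2 = - 1 / 22"
    by simp
  \<comment> \<open>The square of the first symmetric function minus twice the second: 1 +
    2.\<close>
  have p2: "\<alpha>\<^sup>2 + \<beta>\<^sup>2 + \<gamma>\<^sup>2 = 3"
    using e by algebra
  have cube: "x ^ 3 = x\<^sup>2 + x + 1" if "x \<in> {\<alpha>, \<beta>, \<gamma>}" for x
    using roots[OF that] by algebra
  have power_sum: "\<alpha> ^ k + \<beta> ^ k + \<gamma> ^ k = trib 3 1 3 k" for k
    using power_sum_eq_trib[of \<alpha> \<beta> \<gamma> k, OF cube cube cube] unfolding e(1) p2 by simp
  have "fps_exp \<alpha> + fps_exp \<beta> + fps_exp \<gamma> = Abs_fps (\<lambda>k. trib 3 1 3 k / fact k)"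
    by (rule fps_ext) (simp add: power_sum[symmetric] add_divide_distrib)
  then show ?thesis
    unfolding coeff by simp
qed

end
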